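(* Let $R$ be a ring, let $\mathfrak{F}_1\subseteq \mathfrak{F}_2$ be Gabriel filters of right ideals of $R$, with corresponding hereditary torsion theories $\tau_1,\tau_2$, and let $Q_1=R_{\mathfrak{F}_1}$ and $Q_2=R_{\mathfrak{F}_2}$ be the respective right rings of quotients. Suppose that either (i) $\mathfrak{F}_1$ is differential and $Q_1$ is $\tau_2$-torsion-free, (ii) $\mathfrak{F}_1$ and $\mathfrak{F}_2$ are differential, or (iii) $\mathfrak{F}_1$ and $\mathfrak{F}_2$ are faithful. Then any derivation on $R$ extends both to $Q_1$ and to $Q_2$, and the extensions agree.
   Context: Rings are associative with identity and modules are unital. Derivations. A derivation on $R$ is an additive map $\delta:R\to R$ with $\delta(rs)=\delta(r)s+r\delta(s)$. For a right $R$-module $M$, a $\delta$-derivation on $M$ is an additive map $d:M\to M$ with $d(xr)=d(x)r+x\delta(r)$ for all $x\in M$, $r\in R$. In particular $\delta$ is a $\delta$-derivation on the right module $R$. Modules of quotients. A Gabriel filter $\mathfrak{F}$ of right ideals corresponds to a hereditary torsion theory with torsion submodule $\mathcal{T}(M)=\{x\in M : \{r\in R: xr=0\}\in\mathfrak{F}\}$. The filter (or torsion theory) is faithful if $\mathcal{T}(R)=0$. The module of quotients is $M_{\mathfrak{F}}=\varinjlim_{I\in\mathfrak{F}}\mathrm{Hom}_R(I,M/\mathcal{T}(M))$, and $q_M:M\to M_{\mathfrak{F}}$ sends $m$ to the class of left multiplication by $m+\mathcal{T}(M)$. For $M=R$, $R_{\mathfrak{F}}$ is a ring, the right ring of quotients.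 Differential filters. $\mathfrak{F}$ is differential if for every derivation $\delta$ on $R$ and every $I\in\mathfrak{F}$ there is $J\in\mathfrak{F}$ with $\delta(J)\subseteq I$. Extensions. A $\delta$-derivation $d$ on $M$ extends to $M_{\mathfrak{F}}$ if there is a $\delta$-derivation $d'$ on the right $R$-module $M_{\mathfrak{F}}$ with $d'q_M=q_Md$. Agreement. For $\mathfrak{F}_1\subseteq\mathfrak{F}_2$ with torsion submodules $\mathcal{T}_1(M)\subseteq\mathcal{T}_2(M)$ and maps $q_i:M\to M_{\mathfrak{F}_i}$, let $q_{12}:M_{\mathfrak{F}_1}\to M_{\mathfrak{F}_2}$ be the $R$-homomorphism sending the class of $f:I\to M/\mathcal{T}_1(M)$ ($I\in\mathfrak{F}_1$) to the class of the composite of $f$ with the projection $M/\mathcal{T}_1(M)\to M/\mathcal{T}_2(M)$; then $q_{12}q_1=q_2$. The extensions of $d$ on $M_{\mathfrak{F}_1}$ and $M_{\mathfrak{F}_2}$ agree if $d$ extends to $\delta$-derivations $d_i$ on $M_{\mathfrak{F}_i}$ with $d_1q_1=q_1d$, $d_2q_2=q_2d$ and $d_2q_{12}=q_{12}d_1$. For rings of quotients this is applied with $M=R$ and $d=\delta$. *)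

theory Defs
  imports "HOL-Algebra.Ideal"
begin

text \<open>
  The library's modules are left modules over commutative rings, so right modules over an arbitrary
  ring are introduced here. As for library modules, the record extends \<^typ>\<open>'m ring\<close> only in
  order to reuse the additive notation; the fields \<^const>\<open>mult\<close> and \<^const>\<open>one\<close>
  of a module carry no meaning.
\<close>

record ('r, 'm) right_module = "'m ring" +
  rsmult :: "['m, 'r] \<Rightarrow> 'm" (infixl \<open>\<triangleleft>\<index>\<close> 70)

locale right_module = R?: ring R + M?: abelian_group M
  for R (structure) and M :: "('r, 'm, 'x) right_module_scheme" (structure) +
  assumes rsmult_closed: "\<lbrakk>x \<in> carrier M; r \<in> carrier R\<rbrakk> \<Longrightarrow> x \<triangleleft>\<^bsub>M\<^esub> r \<in> carrier M"
    and rsmult_add_left: "\<lbrakk>x \<in> carrier M; y \<in> carrier M; r \<in> carrier R\<rbrakk>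
      \<Longrightarrow> (x \<oplus>\<^bsub>M\<^esub> y) \<triangleleft>\<^bsub>M\<^esub> r = x \<triangleleft>\<^bsub>M\<^esub> r \<oplus>\<^bsub>M\<^esub> y \<triangleleft>\<^bsub>M\<^esub> r"
    and rsmult_add_right: "\<lbrakk>x \<in> carrier M; r \<in> carrier R; s \<in> carrier R\<rbrakk>
      \<Longrightarrow> x \<triangleleft>\<^bsub>M\<^esub> (r \<oplus>\<^bsub>R\<^esub> s) = x \<triangleleft>\<^bsub>M\<^esub> r \<oplus>\<^bsub>M\<^esub> x \<triangleleft>\<^bsub>M\<^esub> s"
    and rsmult_assoc: "\<lbrakk>x \<in> carrier M; r \<in> carrier R; s \<in> carrier R\<rbrakk>
      \<Longrightarrow> x \<triangleleft>\<^bsub>M\<^esub> (r \<otimes>\<^bsub>R\<^esub> s) = (x \<triangleleft>\<^bsub>M\<^esub> r) \<triangleleft>\<^bsub>M\<^esub> s"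
    and rsmult_one: "x \<in> carrier M \<Longrightarrow> x \<triangleleft>\<^bsub>M\<^esub> \<one>\<^bsub>R\<^esub> = x"

definition right_regular :: "('r, 'e) ring_scheme \<Rightarrow> ('r, 'r) right_module" where
  "right_regular R = \<lparr>carrier = carrier R, mult = mult R, one = one R, zero = zero R, add = add R,
     rsmult = mult R\<rparr>"

lemma (in ring) right_regular_module: "right_module R (right_regular R)"
proof -
  have "abelian_group (right_regular R)"
    by (rule abelian_groupI) (auto simp: right_regular_def a_ac intro: l_neg a_inv_closed)
  then show ?thesis
    by (intro right_module.intro right_module_axioms.intro)
       (auto simp: right_regular_def l_distr r_distr m_assoc ring_axioms)
qed

definition right_module_hom ::
  "('r, 'e) ring_scheme \<Rightarrow> ('r, 'm, 'x) right_module_scheme \<Rightarrow> ('r, 'n, 'y) right_module_scheme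
    \<Rightarrow> ('m \<Rightarrow> 'n) set" where
  "right_module_hom R M N = {f \<in> carrier M \<rightarrow>\<^sub>E carrier N.
     (\<forall>x\<in>carrier M. \<forall>y\<in>carrier M. f (x \<oplus>\<^bsub>M\<^esub> y) = f x \<oplus>\<^bsub>N\<^esub> f y) \<and>
     (\<forall>x\<in>carrier M. \<forall>r\<in>carrier R. f (x \<triangleleft>\<^bsub>M\<^esub> r) = f x \<triangleleft>\<^bsub>N\<^esub> r)}"

definition quotient_module ::
  "('r, 'e) ring_scheme \<Rightarrow> ('r, 'm, 'x) right_module_scheme \<Rightarrow> 'm set
    \<Rightarrow> ('r, 'm set) right_module" where
  "quotient_module R M N = \<lparr>carrier = a_rcosets\<^bsub>M\<^esub> N, mult = undefined, one = undefined,
     zero = N, add = set_add M, rsmult = (\<lambda>C r. \<Union>x\<in>C. N +>\<^bsub>M\<^esub> (x \<triangleleft>\<^bsub>M\<^esub> r))\<rparr>"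


section \<open>Gabriel filters and torsion\<close>

definition right_ideal :: "('r, 'e) ring_scheme \<Rightarrow> 'r set \<Rightarrow> bool" where
  "right_ideal R I \<longleftrightarrow>
     additive_subgroup I R \<and> (\<forall>x\<in>I. \<forall>r\<in>carrier R. x \<otimes>\<^bsub>R\<^esub> r \<in> I)"

definition right_colon :: "('r, 'e) ring_scheme \<Rightarrow> 'r set \<Rightarrow> 'r \<Rightarrow> 'r set" where
  "right_colon R I r = {s \<in> carrier R. r \<otimes>\<^bsub>R\<^esub> s \<in> I}"

locale gabriel_filter = ring R for R (structure) and F +
  assumes nonempty: "F \<noteq> {}"
    and right_ideals: "I \<in> F \<Longrightarrow> right_ideal R I"
    and upward: "\<lbrakk>I \<in> F; right_ideal R J; I \<subseteq> J\<rbrakk> \<Longrightarrow> J \<in> F"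
    and inter: "\<lbrakk>I \<in> F; J \<in> F\<rbrakk> \<Longrightarrow> I \<inter> J \<in> F"
    and colon: "\<lbrakk>I \<in> F; r \<in> carrier R\<rbrakk> \<Longrightarrow> right_colon R I r \<in> F"
    and gabriel: "\<lbrakk>J \<in> F; right_ideal R I; \<And>r. r \<in> J \<Longrightarrow> right_colon R I r \<in> F\<rbrakk> \<Longrightarrow> I \<in> F"

definition torsion ::
  "('r, 'e) ring_scheme \<Rightarrow> 'r set set \<Rightarrow> ('r, 'm, 'x) right_module_scheme \<Rightarrow> 'm set" where
  "torsion R F M = {x \<in> carrier M. {r \<in> carrier R. x \<triangleleft>\<^bsub>M\<^esub> r = \<zero>\<^bsub>M\<^esub>} \<in> F}"

definition torsion_free ::
  "('r, 'e) ring_scheme \<Rightarrow> 'r set set \<Rightarrow> ('r, 'm, 'x) right_module_scheme \<Rightarrow> bool" where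
  "torsion_free R F M \<longleftrightarrow> torsion R F M = {\<zero>\<^bsub>M\<^esub>}"

definition faithful_filter :: "('r, 'e) ring_scheme \<Rightarrow> 'r set set \<Rightarrow> bool" where
  "faithful_filter R F \<longleftrightarrow> torsion_free R F (right_regular R)"


section \<open>Modules of quotients\<close>

definition torsion_quotient ::
  "('r, 'e) ring_scheme \<Rightarrow> 'r set set \<Rightarrow> ('r, 'm, 'x) right_module_scheme
    \<Rightarrow> ('r, 'm set) right_module" where
  "torsion_quotient R F M = quotient_module R M (torsion R F M)"

text \<open>
  The direct limit of the groups \<open>Hom(I, M/T(M))\<close>, for \<open>I\<close> in \<open>F\<close>
  ordered by reverse inclusion, is the disjoint union \<open>quot_pairs\<close> of these groups modulo
  the relation \<open>quot_rel\<close> of having the same restriction to some member of \<open>F\<close>.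
\<close>

definition quot_pairs ::
  "('r, 'e) ring_scheme \<Rightarrow> 'r set set \<Rightarrow> ('r, 'm, 'x) right_module_scheme
    \<Rightarrow> ('r set \<times> ('r \<Rightarrow> 'm set)) set" where
  "quot_pairs R F M =
     (SIGMA I:F. right_module_hom R (right_regular R\<lparr>carrier := I\<rparr>) (torsion_quotient R F M))"

definition quot_rel ::
  "('r, 'e) ring_scheme \<Rightarrow> 'r set set \<Rightarrow> ('r, 'm, 'x) right_module_scheme
    \<Rightarrow> ('r set \<times> ('r \<Rightarrow> 'm set)) rel" where
  "quot_rel R F M = {((I, f), (J, g)). (I, f) \<in> quot_pairs R F M \<and> (J, g) \<in> quot_pairs R F M \<and>
     (\<exists>K\<in>F. K \<subseteq> I \<inter> J \<and> (\<forall>x\<in>K. f x = g x))}"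

definition quot_class ::
  "('r, 'e) ring_scheme \<Rightarrow> 'r set set \<Rightarrow> ('r, 'm, 'x) right_module_scheme
    \<Rightarrow> 'r set \<Rightarrow> ('r \<Rightarrow> 'm set) \<Rightarrow> ('r set \<times> ('r \<Rightarrow> 'm set)) set" where
  "quot_class R F M I f = quot_rel R F M `` {(I, f)}"

text \<open>
  Operations on classes are unions over all representatives; as each operation is independent of
  the representatives, such a union is a single class. The scalar action is
  \<open>(f r)(s) = f (r s)\<close>.
\<close>

definition module_of_quotients ::
  "('r, 'e) ring_scheme \<Rightarrow> 'r set set \<Rightarrow> ('r, 'm, 'x) right_module_scheme
    \<Rightarrow> ('r, ('r set \<times> ('r \<Rightarrow> 'm set)) set) right_module" where
  "module_of_quotients R F M =
     \<lparr>carrier = quot_pairs R F M // quot_rel R F M,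
      mult = undefined,
      one = undefined,
      zero = quot_class R F M (carrier R) (\<lambda>s\<in>carrier R. \<zero>\<^bsub>torsion_quotient R F M\<^esub>),
      add = (\<lambda>X Y. \<Union>(I, f)\<in>X. \<Union>(J, g)\<in>Y.
        quot_class R F M (I \<inter> J) (\<lambda>s\<in>I \<inter> J. f s \<oplus>\<^bsub>torsion_quotient R F M\<^esub> g s)),
      rsmult = (\<lambda>X r. \<Union>(I, f)\<in>X.
        quot_class R F M (right_colon R I r) (\<lambda>s\<in>right_colon R I r. f (r \<otimes>\<^bsub>R\<^esub> s)))\<rparr>"

definition quot_map ::
  "('r, 'e) ring_scheme \<Rightarrow> 'r set set \<Rightarrow> ('r, 'm, 'x) right_module_scheme
    \<Rightarrow> 'm \<Rightarrow> ('r set \<times> ('r \<Rightarrow> 'm set)) set" where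
  "quot_map R F M m = quot_class R F M (carrier R)
     (\<lambda>r\<in>carrier R. (torsion R F M +>\<^bsub>M\<^esub> m) \<triangleleft>\<^bsub>torsion_quotient R F M\<^esub> r)"

definition quot_transition ::
  "('r, 'e) ring_scheme \<Rightarrow> 'r set set \<Rightarrow> 'r set set \<Rightarrow> ('r, 'm, 'x) right_module_scheme
    \<Rightarrow> ('r set \<times> ('r \<Rightarrow> 'm set)) set \<Rightarrow> ('r set \<times> ('r \<Rightarrow> 'm set)) set" where
  "quot_transition R F\<^sub>1 F\<^sub>2 M X =
     (\<Union>(I, f)\<in>X. quot_class R F\<^sub>2 M I (\<lambda>s\<in>I. \<Union>x\<in>f s. torsion R F\<^sub>2 M +>\<^bsub>M\<^esub> x))"

text \<open>
  The ring of quotients enters only as a right \<open>R\<close>-module: torsion-freeness and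
  extensions of derivations refer to no other structure, so its multiplication is not defined.
\<close>

abbreviation ring_of_quotients ::
  "('r, 'e) ring_scheme \<Rightarrow> 'r set set \<Rightarrow> ('r, ('r set \<times> ('r \<Rightarrow> 'r set)) set) right_module" where
  "ring_of_quotients R F \<equiv> module_of_quotients R F (right_regular R)"


section \<open>Derivations and their extensions\<close>

definition derivation :: "('r, 'e) ring_scheme \<Rightarrow> ('r \<Rightarrow> 'r) \<Rightarrow> bool" where
  "derivation R \<delta> \<longleftrightarrow> \<delta> \<in> carrier R \<rightarrow> carrier R \<and>
     (\<forall>r\<in>carrier R. \<forall>s\<in>carrier R. \<delta> (r \<oplus>\<^bsub>R\<^esub> s) = \<delta> r \<oplus>\<^bsub>R\<^esub> \<delta> s) \<and>
     (\<forall>r\<in>carrier R. \<forall>s\<in>carrier R. \<delta> (r \<otimes>\<^bsub>R\<^esub> s) = \<delta> r \<otimes>\<^bsub>R\<^esub> s \<oplus>\<^bsub>R\<^esub> r \<otimes>\<^bsub>R\<^esub> \<delta> s)"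

definition module_derivation ::
  "('r, 'e) ring_scheme \<Rightarrow> ('r \<Rightarrow> 'r) \<Rightarrow> ('r, 'm, 'x) right_module_scheme \<Rightarrow> ('m \<Rightarrow> 'm) \<Rightarrow> bool" where
  "module_derivation R \<delta> M d \<longleftrightarrow> d \<in> carrier M \<rightarrow> carrier M \<and>
     (\<forall>x\<in>carrier M. \<forall>y\<in>carrier M. d (x \<oplus>\<^bsub>M\<^esub> y) = d x \<oplus>\<^bsub>M\<^esub> d y) \<and>
     (\<forall>x\<in>carrier M. \<forall>r\<in>carrier R. d (x \<triangleleft>\<^bsub>M\<^esub> r) = d x \<triangleleft>\<^bsub>M\<^esub> r \<oplus>\<^bsub>M\<^esub> x \<triangleleft>\<^bsub>M\<^esub> \<delta> r)"

definition differential_filter :: "('r, 'e) ring_scheme \<Rightarrow> 'r set set \<Rightarrow> bool" where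
  "differential_filter R F \<longleftrightarrow> (\<forall>\<delta>. derivation R \<delta> \<longrightarrow> (\<forall>I\<in>F. \<exists>J\<in>F. \<delta> ` J \<subseteq> I))"

definition is_extension ::
  "('r, 'e) ring_scheme \<Rightarrow> ('r \<Rightarrow> 'r) \<Rightarrow> 'r set set \<Rightarrow> ('r, 'm, 'x) right_module_scheme
    \<Rightarrow> ('m \<Rightarrow> 'm) \<Rightarrow> (('r set \<times> ('r \<Rightarrow> 'm set)) set \<Rightarrow> ('r set \<times> ('r \<Rightarrow> 'm set)) set) \<Rightarrow> bool" where
  "is_extension R \<delta> F M d d' \<longleftrightarrow> module_derivation R \<delta> (module_of_quotients R F M) d' \<and>
     (\<forall>x\<in>carrier M. d' (quot_map R F M x) = quot_map R F M (d x))"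

definition extends ::
  "('r, 'e) ring_scheme \<Rightarrow> ('r \<Rightarrow> 'r) \<Rightarrow> 'r set set \<Rightarrow> ('r, 'm, 'x) right_module_scheme
    \<Rightarrow> ('m \<Rightarrow> 'm) \<Rightarrow> bool" where
  "extends R \<delta> F M d \<longleftrightarrow> (\<exists>d'. is_extension R \<delta> F M d d')"

definition extensions_agree ::
  "('r, 'e) ring_scheme \<Rightarrow> ('r \<Rightarrow> 'r) \<Rightarrow> 'r set set \<Rightarrow> 'r set set
    \<Rightarrow> ('r, 'm, 'x) right_module_scheme \<Rightarrow> ('m \<Rightarrow> 'm) \<Rightarrow> bool" where
  "extensions_agree R \<delta> F\<^sub>1 F\<^sub>2 M d \<longleftrightarrow>
     (\<exists>d\<^sub>1 d\<^sub>2. is_extension R \<delta> F\<^sub>1 M d d\<^sub>1 \<and> is_extension R \<delta> F\<^sub>2 M d d\<^sub>2 \<and>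
       (\<forall>X\<in>carrier (module_of_quotients R F\<^sub>1 M).
          d\<^sub>2 (quot_transition R F\<^sub>1 F\<^sub>2 M X) = quot_transition R F\<^sub>1 F\<^sub>2 M (d\<^sub>1 X)))"

end

theory Submission
  imports Defs
begin

text \<open>
  Every Gabriel filter \<open>F\<close> is differential: for \<open>I\<close> in \<open>F\<close> the right ideal
  \<open>K = {s \<in> I. \<delta> s \<in> I}\<close> satisfies \<open>(K : s) \<supseteq> (I : \<delta> s)\<close> for \<open>s \<in> I\<close>, whence
  \<open>K \<in> F\<close>. So a \<open>\<delta>\<close>-derivation \<open>d\<close> of \<open>M\<close> preserves the torsion submodule \<open>T(M)\<close>, and it
  extends to the module of quotients by sending the class of \<open>f : I \<rightarrow> M/T(M)\<close> to the class of
  \<open>s \<mapsto> d (f s) - f (\<delta> s)\<close> on \<open>K\<close>. This formula commutes with enlarging the filter, as \<open>K\<close> does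
  not depend on \<open>F\<close>.
\<close>

section \<open>Right ideals and right modules\<close>

text \<open>Negatives come from the identity element:
  \<open>\<ominus> x = x \<otimes> \<ominus> \<one>\<close>, so closure under right multiplication
  already yields them.\<close>

lemma (in ring) right_idealI:
  assumes "I \<subseteq> carrier R" and "\<zero> \<in> I"
    and "\<And>x y. \<lbrakk>x \<in> I; y \<in> I\<rbrakk> \<Longrightarrow> x \<oplus> y \<in> I"
    and "\<And>x r. \<lbrakk>x \<in> I; r \<in> carrier R\<rbrakk> \<Longrightarrow> x \<otimes> r \<in> I"
  shows "right_ideal R I"
proof -
  have "\<ominus> x \<in> I" if "x \<in> I" for x
  proof -
    have "\<ominus> x = x \<otimes> \<ominus> \<one>"
      using that assms(1) by (auto simp: r_minus)
    then show ?thesis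
      using assms(4)[OF that] by simp
  qed
  then have "subgroup I (add_monoid R)"
    using assms by (intro add.subgroupI) (auto simp: a_inv_def)
  then show ?thesis
    using assms(4) by (auto simp: right_ideal_def intro: additive_subgroupI)
qed

lemma right_ideal_subset: "right_ideal R I \<Longrightarrow> I \<subseteq> carrier R"
  by (auto simp: right_ideal_def dest: additive_subgroup.a_subset)

lemma right_ideal_zero: "right_ideal R I \<Longrightarrow> \<zero>\<^bsub>R\<^esub> \<in> I"
  by (auto simp: right_ideal_def dest: additive_subgroup.zero_closed)

lemma right_ideal_add: "\<lbrakk>right_ideal R I; x \<in> I; y \<in> I\<rbrakk> \<Longrightarrow> x \<oplus>\<^bsub>R\<^esub> y \<in> I"
  by (auto simp: right_ideal_def dest: additive_subgroup.a_closed)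

lemma right_ideal_mult: "\<lbrakk>right_ideal R I; x \<in> I; r \<in> carrier R\<rbrakk> \<Longrightarrow> x \<otimes>\<^bsub>R\<^esub> r \<in> I"
  by (auto simp: right_ideal_def)

lemma (in ring) right_ideal_colon:
  assumes "right_ideal R I" "r \<in> carrier R"
  shows "right_ideal R (right_colon R I r)"
  using assms right_ideal_zero[OF assms(1)] right_ideal_add[OF assms(1)] right_ideal_mult[OF assms(1)]
  by (intro right_idealI) (auto simp: right_colon_def r_distr m_assoc[symmetric])

context right_module
begin

lemma zero_rsmult [simp]:
  assumes "r \<in> carrier R" shows "\<zero>\<^bsub>M\<^esub> \<triangleleft>\<^bsub>M\<^esub> r = \<zero>\<^bsub>M\<^esub>"
proof -
  have "\<zero>\<^bsub>M\<^esub> \<triangleleft>\<^bsub>M\<^esub> r \<oplus>\<^bsub>M\<^esub> \<zero>\<^bsub>M\<^esub> \<triangleleft>\<^bsub>M\<^esub> r = \<zero>\<^bsub>M\<^esub> \<triangleleft>\<^bsub>M\<^esub> r"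
    using rsmult_add_left[of "\<zero>\<^bsub>M\<^esub>" "\<zero>\<^bsub>M\<^esub>" r] assms by simp
  then show ?thesis
    using assms by (metis M.add.r_cancel_one' M.zero_closed rsmult_closed)
qed

lemma rsmult_zero [simp]:
  assumes "x \<in> carrier M" shows "x \<triangleleft>\<^bsub>M\<^esub> \<zero>\<^bsub>R\<^esub> = \<zero>\<^bsub>M\<^esub>"
proof -
  have "x \<triangleleft>\<^bsub>M\<^esub> \<zero>\<^bsub>R\<^esub> \<oplus>\<^bsub>M\<^esub> x \<triangleleft>\<^bsub>M\<^esub> \<zero>\<^bsub>R\<^esub> = x \<triangleleft>\<^bsub>M\<^esub> \<zero>\<^bsub>R\<^esub>"
    using rsmult_add_right[of x "\<zero>\<^bsub>R\<^esub>" "\<zero>\<^bsub>R\<^esub>"] assms by simp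
  then show ?thesis
    using assms by (metis M.add.r_cancel_one' R.zero_closed rsmult_closed)
qed

lemma minus_rsmult:
  assumes "x \<in> carrier M" "r \<in> carrier R"
  shows "(\<ominus>\<^bsub>M\<^esub> x) \<triangleleft>\<^bsub>M\<^esub> r = \<ominus>\<^bsub>M\<^esub> (x \<triangleleft>\<^bsub>M\<^esub> r)"
proof -
  have "(\<ominus>\<^bsub>M\<^esub> x) \<triangleleft>\<^bsub>M\<^esub> r \<oplus>\<^bsub>M\<^esub> x \<triangleleft>\<^bsub>M\<^esub> r = \<zero>\<^bsub>M\<^esub>"
    using rsmult_add_left[of "\<ominus>\<^bsub>M\<^esub> x" x r] assms by (simp add: M.l_neg)
  then show ?thesis
    using assms by (metis M.a_inv_closed M.minus_equality rsmult_closed)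
qed

lemma right_ideal_annihilator:
  "x \<in> carrier M \<Longrightarrow> right_ideal R {r \<in> carrier R. x \<triangleleft>\<^bsub>M\<^esub> r = \<zero>\<^bsub>M\<^esub>}"
  by (intro R.right_idealI) (auto simp: rsmult_add_right rsmult_assoc)

end

lemma (in gabriel_filter) mem_carrier: "\<lbrakk>I \<in> F; r \<in> I\<rbrakk> \<Longrightarrow> r \<in> carrier R"
  using right_ideal_subset[OF right_ideals] by blast

lemma (in gabriel_filter) carrier_mem: "carrier R \<in> F"
proof -
  obtain I where I: "I \<in> F"
    using nonempty by blast
  have "right_ideal R (carrier R)"
    by (rule right_idealI) auto
  then show ?thesis
    using upward[OF I] right_ideal_subset[OF right_ideals[OF I]] by blast
qed


section \<open>The module modulo its torsion\<close>

locale gabriel_module = R?: gabriel_filter R F + right_module R M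
  for R (structure) and F and M :: "('r, 'm, 'x) right_module_scheme" (structure)
begin

abbreviation T where "T \<equiv> torsion R F M"
abbreviation Q where "Q \<equiv> torsion_quotient R F M"
abbreviation cos where "cos x \<equiv> T +>\<^bsub>M\<^esub> x"

text \<open>An annihilator is a right ideal and \<open>F\<close> is upward closed, so the
  annihilator lies in \<open>F\<close> as soon as it contains some member of \<open>F\<close>.
  Torsion can thus be shown by exhibiting one member that kills the element.\<close>

lemma torsion_iff:
  "x \<in> T \<longleftrightarrow> x \<in> carrier M \<and> (\<exists>I\<in>F. \<forall>r\<in>I. x \<triangleleft>\<^bsub>M\<^esub> r = \<zero>\<^bsub>M\<^esub>)"
proof
  assume "x \<in> T"
  then show "x \<in> carrier M \<and> (\<exists>I\<in>F. \<forall>r\<in>I. x \<triangleleft>\<^bsub>M\<^esub> r = \<zero>\<^bsub>M\<^esub>)"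
    by (intro conjI bexI[of _ "{r \<in> carrier R. x \<triangleleft>\<^bsub>M\<^esub> r = \<zero>\<^bsub>M\<^esub>}"]) (simp_all add: torsion_def)
next
  assume *: "x \<in> carrier M \<and> (\<exists>I\<in>F. \<forall>r\<in>I. x \<triangleleft>\<^bsub>M\<^esub> r = \<zero>\<^bsub>M\<^esub>)"
  then obtain I where I: "I \<in> F" "\<forall>r\<in>I. x \<triangleleft>\<^bsub>M\<^esub> r = \<zero>\<^bsub>M\<^esub>"
    by blast
  have "I \<subseteq> {r \<in> carrier R. x \<triangleleft>\<^bsub>M\<^esub> r = \<zero>\<^bsub>M\<^esub>}"
    using I right_ideal_subset[OF right_ideals[OF I(1)]] by blast
  then have "{r \<in> carrier R. x \<triangleleft>\<^bsub>M\<^esub> r = \<zero>\<^bsub>M\<^esub>} \<in> F"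
    using * by (intro upward[OF I(1)] right_ideal_annihilator) simp_all
  then show "x \<in> T"
    using * by (simp add: torsion_def)
qed

lemma torsionI:
  "\<lbrakk>x \<in> carrier M; I \<in> F; \<And>r. r \<in> I \<Longrightarrow> x \<triangleleft>\<^bsub>M\<^esub> r = \<zero>\<^bsub>M\<^esub>\<rbrakk> \<Longrightarrow> x \<in> T"
  unfolding torsion_iff by blast

lemma torsion_rsmult:
  assumes "x \<in> T" "r \<in> carrier R"
  shows "x \<triangleleft>\<^bsub>M\<^esub> r \<in> T"
proof -
  obtain I where x: "x \<in> carrier M" and I: "I \<in> F" "\<forall>r\<in>I. x \<triangleleft>\<^bsub>M\<^esub> r = \<zero>\<^bsub>M\<^esub>"
    using assms by (auto simp: torsion_iff)
  show ?thesis
    using x I assms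
    \<comment> \<open>If \<open>I\<close> kills \<open>x\<close>, then the colon ideal
      \<open>(I : r)\<close> kills \<open>x r\<close>, because \<open>(x r) s = x (r s)\<close> with
      \<open>r s \<in> I\<close>.\<close>
    by (intro torsionI[OF _ colon[OF I(1) assms(2)]])
       (auto simp: right_colon_def rsmult_closed rsmult_assoc[symmetric])
qed

lemma torsion_additive_subgroup: "additive_subgroup T M"
proof (rule additive_subgroupI)
  show "subgroup T (add_monoid M)"
  proof (rule M.add.subgroupI)
    show "T \<subseteq> carrier M"
      by (auto simp: torsion_def)
    have "\<zero>\<^bsub>M\<^esub> \<in> T"
      by (intro torsionI[OF _ carrier_mem]) simp_all
    then show "T \<noteq> {}"
      by blast
  next
    fix x assume "x \<in> T"
    then obtain I where I: "x \<in> carrier M" "I \<in> F" "\<forall>r\<in>I. x \<triangleleft>\<^bsub>M\<^esub> r = \<zero>\<^bsub>M\<^esub>"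
      by (auto simp: torsion_iff)
    then show "\<ominus>\<^bsub>M\<^esub> x \<in> T"
      by (intro torsionI[OF _ I(2)]) (simp_all add: minus_rsmult mem_carrier)
  next
    fix x y assume "x \<in> T" "y \<in> T"
    then obtain I J where IJ: "x \<in> carrier M" "y \<in> carrier M" "I \<in> F" "J \<in> F"
      "\<forall>r\<in>I. x \<triangleleft>\<^bsub>M\<^esub> r = \<zero>\<^bsub>M\<^esub>" "\<forall>r\<in>J. y \<triangleleft>\<^bsub>M\<^esub> r = \<zero>\<^bsub>M\<^esub>"
      by (auto simp: torsion_iff)
    then show "x \<oplus>\<^bsub>M\<^esub> y \<in> T"
      by (intro torsionI[OF _ inter[OF IJ(3,4)]]) (simp_all add: rsmult_add_left mem_carrier)
  qed
qed

lemma torsion_abelian_subgroup: "abelian_subgroup T M"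
  using torsion_additive_subgroup by (intro abelian_subgroupI3) (auto intro: M.abelian_group_axioms)

lemma torsion_carrier: "t \<in> T \<Longrightarrow> t \<in> carrier M"
  by (simp add: torsion_def)

lemma torsion_coset [simp]: "t \<in> T \<Longrightarrow> cos t = T"
  using torsion_additive_subgroup
  by (intro M.a_coset_join2) (simp_all add: torsion_carrier additive_subgroup_def)

lemma coset_add: "\<lbrakk>x \<in> carrier M; y \<in> carrier M\<rbrakk> \<Longrightarrow> cos x <+>\<^bsub>M\<^esub> cos y = cos (x \<oplus>\<^bsub>M\<^esub> y)"
  by (rule abelian_subgroup.a_rcos_sum[OF torsion_abelian_subgroup])

lemma coset_absorb:
  assumes "t \<in> T" "x \<in> carrier M" shows "cos (t \<oplus>\<^bsub>M\<^esub> x) = cos x"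
  using assms
  by (intro sym[OF abelian_subgroup.a_repr_independence'[OF torsion_abelian_subgroup]])
     (auto simp: a_r_coset_def')

text \<open>Operations on cosets are unions over all representatives. When \<open>h\<close> has the
  same value at each of them, the union collapses to that value; \<open>T\<close> being nonempty
  excludes the empty union.\<close>

lemma UN_coset:
  assumes "\<And>t. t \<in> T \<Longrightarrow> h (t \<oplus>\<^bsub>M\<^esub> x) = c"
  shows "(\<Union>y\<in>cos x. h y) = c"
proof -
  have "T \<noteq> {}"
    using additive_subgroup.zero_closed[OF torsion_additive_subgroup] by blast
  then show ?thesis
    using assms by (auto simp: a_r_coset_def')
qed

lemma carrier_Q: "C \<in> carrier Q \<longleftrightarrow> (\<exists>x\<in>carrier M. C = cos x)"
  by (auto simp: torsion_quotient_def quotient_module_def A_RCOSETS_def')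

lemma carrier_QE:
  assumes "C \<in> carrier Q" obtains x where "x \<in> carrier M" "C = cos x"
  using assms by (auto simp: carrier_Q)

lemma coset_closed [simp]: "x \<in> carrier M \<Longrightarrow> cos x \<in> carrier Q"
  by (auto simp: carrier_Q)

text \<open>The zero of the quotient is the subgroup \<open>T\<close> itself. Written as a coset it
  has the same shape as every other element, so the rules for cosets apply to it.\<close>

lemma zero_Q: "\<zero>\<^bsub>Q\<^esub> = cos \<zero>\<^bsub>M\<^esub>"
  using additive_subgroup.zero_closed[OF torsion_additive_subgroup]
  by (simp add: torsion_quotient_def quotient_module_def)

lemma add_Q [simp]:
  "\<lbrakk>x \<in> carrier M; y \<in> carrier M\<rbrakk> \<Longrightarrow> cos x \<oplus>\<^bsub>Q\<^esub> cos y = cos (x \<oplus>\<^bsub>M\<^esub> y)"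
  by (simp add: coset_add torsion_quotient_def quotient_module_def)

lemma rsmult_Q [simp]:
  assumes "x \<in> carrier M" "r \<in> carrier R"
  shows "cos x \<triangleleft>\<^bsub>Q\<^esub> r = cos (x \<triangleleft>\<^bsub>M\<^esub> r)"
proof -
  have "(\<Union>y\<in>cos x. cos (y \<triangleleft>\<^bsub>M\<^esub> r)) = cos (x \<triangleleft>\<^bsub>M\<^esub> r)"
    using assms
    by (intro UN_coset)
       (simp add: rsmult_add_left torsion_carrier coset_absorb torsion_rsmult rsmult_closed)
  then show ?thesis
    by (simp add: torsion_quotient_def quotient_module_def)
qed

lemma torsion_quotient_module: "right_module R Q"
proof -
  have "abelian_group Q"
  proof (rule abelian_groupI)
    fix C assume "C \<in> carrier Q"
    then obtain x where x: "x \<in> carrier M" "C = cos x"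
      by (rule carrier_QE)
    then have "cos (\<ominus>\<^bsub>M\<^esub> x) \<oplus>\<^bsub>Q\<^esub> C = \<zero>\<^bsub>Q\<^esub>"
      by (simp add: zero_Q M.l_neg)
    then show "\<exists>D\<in>carrier Q. D \<oplus>\<^bsub>Q\<^esub> C = \<zero>\<^bsub>Q\<^esub>"
      using x(1) by (intro bexI[of _ "cos (\<ominus>\<^bsub>M\<^esub> x)"]) simp_all
  qed (auto simp: zero_Q M.a_ac elim!: carrier_QE)
  then show ?thesis
    by (intro right_module.intro right_module_axioms.intro)
       (auto elim!: carrier_QE intro: R.ring_axioms
         simp: rsmult_closed rsmult_add_left rsmult_add_right rsmult_assoc rsmult_one)
qed

end

sublocale gabriel_module \<subseteq> Q: right_module R "torsion_quotient R F M"
  by (rule torsion_quotient_module)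


section \<open>Classes of partial homomorphisms\<close>

context gabriel_module
begin

abbreviation cls where "cls \<equiv> quot_class R F M"

lemma pair_iff:
  "(I, f) \<in> quot_pairs R F M \<longleftrightarrow> I \<in> F \<and> f \<in> I \<rightarrow>\<^sub>E carrier Q \<and>
     (\<forall>x\<in>I. \<forall>y\<in>I. f (x \<oplus>\<^bsub>R\<^esub> y) = f x \<oplus>\<^bsub>Q\<^esub> f y) \<and>
     (\<forall>x\<in>I. \<forall>r\<in>carrier R. f (x \<otimes>\<^bsub>R\<^esub> r) = f x \<triangleleft>\<^bsub>Q\<^esub> r)"
  by (auto simp: quot_pairs_def right_module_hom_def right_regular_def)

text \<open>The restriction makes the function extensional, as membership in
  \<open>\<rightarrow>\<^sub>E\<close> demands. Since \<open>I\<close> is closed under sums and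
  right multiples, the equations for \<open>f\<close> on \<open>I\<close> pass to the
  restriction.\<close>

lemma pairI:
  assumes "I \<in> F" and "\<And>x. x \<in> I \<Longrightarrow> f x \<in> carrier Q"
    and "\<And>x y. \<lbrakk>x \<in> I; y \<in> I\<rbrakk> \<Longrightarrow> f (x \<oplus>\<^bsub>R\<^esub> y) = f x \<oplus>\<^bsub>Q\<^esub> f y"
    and "\<And>x r. \<lbrakk>x \<in> I; r \<in> carrier R\<rbrakk> \<Longrightarrow> f (x \<otimes>\<^bsub>R\<^esub> r) = f x \<triangleleft>\<^bsub>Q\<^esub> r"
  shows "(I, \<lambda>x\<in>I. f x) \<in> quot_pairs R F M"
  using assms right_ideal_add[OF right_ideals[OF assms(1)]] right_ideal_mult[OF right_ideals[OF assms(1)]]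
  unfolding pair_iff by auto

lemma pairD:
  assumes "(I, f) \<in> quot_pairs R F M"
  shows "I \<in> F" and "right_ideal R I" and "x \<in> I \<Longrightarrow> x \<in> carrier R"
    and "x \<in> I \<Longrightarrow> f x \<in> carrier Q"
    and "\<lbrakk>x \<in> I; y \<in> I\<rbrakk> \<Longrightarrow> f (x \<oplus>\<^bsub>R\<^esub> y) = f x \<oplus>\<^bsub>Q\<^esub> f y"
    and "\<lbrakk>x \<in> I; r \<in> carrier R\<rbrakk> \<Longrightarrow> f (x \<otimes>\<^bsub>R\<^esub> r) = f x \<triangleleft>\<^bsub>Q\<^esub> r"
  using assms right_ideals right_ideal_subset[OF right_ideals] unfolding pair_iff by blast+

lemma quot_relI:
  "\<lbrakk>(I, f) \<in> quot_pairs R F M; (J, g) \<in> quot_pairs R F M; A \<in> F; A \<subseteq> I; A \<subseteq> J; \<And>x. x \<in> A \<Longrightarrow> f x = g x\<rbrakk>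
    \<Longrightarrow> ((I, f), (J, g)) \<in> quot_rel R F M"
  unfolding quot_rel_def mem_Collect_eq prod.case by (intro conjI bexI[of _ A]) simp_all

lemma quot_relE:
  assumes "(p, q) \<in> quot_rel R F M"
  obtains I f J g A where "p = (I, f)" "q = (J, g)" "(I, f) \<in> quot_pairs R F M" "(J, g) \<in> quot_pairs R F M"
    "A \<in> F" "A \<subseteq> I" "A \<subseteq> J" "\<forall>x\<in>A. f x = g x"
  using assms unfolding quot_rel_def by auto

lemma equiv_quot_rel: "equiv (quot_pairs R F M) (quot_rel R F M)"
proof (rule equivI)
  show "quot_rel R F M \<subseteq> quot_pairs R F M \<times> quot_pairs R F M"
    by (auto simp: quot_rel_def)
  show "refl_on (quot_pairs R F M) (quot_rel R F M)"
    using pairD(1) unfolding refl_on_def by (auto intro!: quot_relI)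
  show "sym (quot_rel R F M)"
  proof (rule symI)
    fix p q assume "(p, q) \<in> quot_rel R F M"
    then show "(q, p) \<in> quot_rel R F M"
      by (elim quot_relE) (simp add: quot_relI)
  qed
  show "trans (quot_rel R F M)"
  proof (rule transI)
    fix p q w
    assume "(p, q) \<in> quot_rel R F M" "(q, w) \<in> quot_rel R F M"
    then show "(p, w) \<in> quot_rel R F M"
    proof (elim quot_relE)
      fix I f J g J' g' L h A B
      assume "p = (I, f)" "q = (J, g)" "q = (J', g')" "w = (L, h)"
        and "(I, f) \<in> quot_pairs R F M" "(L, h) \<in> quot_pairs R F M"
        and "A \<in> F" "A \<subseteq> I" "\<forall>x\<in>A. f x = g x"
        and "B \<in> F" "B \<subseteq> L" "\<forall>x\<in>B. g' x = h x"
      then show "(p, w) \<in> quot_rel R F M"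
        \<comment> \<open>Agreement of the first two maps on \<open>A\<close> and of the last two on
          \<open>B\<close> gives agreement of the outer two on \<open>A \<inter> B\<close>.\<close>
        by (auto intro!: quot_relI[OF _ _ inter[of A B]])
    qed
  qed
qed

text \<open>Equality in the direct limit may be tested on any member \<open>A\<close> of
  \<open>F\<close> inside both domains, however small. The identities between classes of explicit
  representatives below are proved through this rule.\<close>

lemma class_eqI:
  assumes "(I, f) \<in> quot_pairs R F M" "(J, g) \<in> quot_pairs R F M" "A \<in> F" "A \<subseteq> I" "A \<subseteq> J"
    and "\<And>x. x \<in> A \<Longrightarrow> f x = g x"
  shows "cls I f = cls J g"
  unfolding quot_class_def using assms by (intro equiv_class_eq[OF equiv_quot_rel] quot_relI)

lemma class_closed: "(I, f) \<in> quot_pairs R F M \<Longrightarrow> cls I f \<in> carrier (module_of_quotients R F M)"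
  by (auto simp: module_of_quotients_def quot_class_def intro: quotientI)

lemma classE:
  assumes "X \<in> carrier (module_of_quotients R F M)"
  obtains I f where "(I, f) \<in> quot_pairs R F M" "X = cls I f"
  using assms by (auto simp: module_of_quotients_def quot_class_def elim!: quotientE)

text \<open>The counterpart of \<open>UN_coset\<close> for the direct limit: a union over all
  representatives is evaluated at one of them, once \<open>h\<close> is known to depend only on the
  map up to agreement on a member of \<open>F\<close>.\<close>

lemma UN_class:
  assumes "(I, f) \<in> quot_pairs R F M"
    and "\<And>I f J g A. \<lbrakk>(I, f) \<in> quot_pairs R F M; (J, g) \<in> quot_pairs R F M; A \<in> F; A \<subseteq> I; A \<subseteq> J;
      \<And>x. x \<in> A \<Longrightarrow> f x = g x\<rbrakk> \<Longrightarrow> h I f = h J g"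
  shows "(\<Union>(J, g)\<in>cls I f. h J g) = h I f"
proof -
  have "(\<lambda>(I, f). h I f) respects quot_rel R F M"
  proof (rule congruentI)
    fix p q assume "(p, q) \<in> quot_rel R F M"
    then obtain I f J g A where pq: "p = (I, f)" "q = (J, g)"
      and *: "(I, f) \<in> quot_pairs R F M" "(J, g) \<in> quot_pairs R F M"
        "A \<in> F" "A \<subseteq> I" "A \<subseteq> J" "\<forall>x\<in>A. f x = g x"
      by (rule quot_relE)
    show "(case p of (I, f) \<Rightarrow> h I f) = (case q of (I, f) \<Rightarrow> h I f)"
      unfolding pq prod.case by (rule assms(2)[OF *(1-5)]) (use *(6) in blast)
  qed
  from UN_equiv_class[OF equiv_quot_rel this assms(1)] show ?thesis
    by (simp add: quot_class_def)
qed

section \<open>Operations on classes, computed on representatives\<close>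

lemma pair_add:
  assumes f: "(I, f) \<in> quot_pairs R F M" and g: "(J, g) \<in> quot_pairs R F M"
  shows "(I \<inter> J, \<lambda>s\<in>I \<inter> J. f s \<oplus>\<^bsub>Q\<^esub> g s) \<in> quot_pairs R F M"
  by (rule pairI) (auto simp: pairD[OF f] pairD[OF g] inter Q.rsmult_add_left Q.M.a_ac)

lemma class_add:
  assumes f: "(I, f) \<in> quot_pairs R F M" and g: "(J, g) \<in> quot_pairs R F M"
  shows "cls I f \<oplus>\<^bsub>module_of_quotients R F M\<^esub> cls J g
    = cls (I \<inter> J) (\<lambda>s\<in>I \<inter> J. f s \<oplus>\<^bsub>Q\<^esub> g s)"
proof -
  let ?h = "\<lambda>I f J g. cls (I \<inter> J) (\<lambda>s\<in>I \<inter> J. f s \<oplus>\<^bsub>Q\<^esub> g s)"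
  \<comment> \<open>Independence of both representatives at once. The two unions are then removed
    one after the other, the fixed pair agreeing with itself on its whole domain.\<close>
  have *: "?h I f J g = ?h I' f' J' g'"
    if "(I, f) \<in> quot_pairs R F M" "(I', f') \<in> quot_pairs R F M" "A \<in> F" "A \<subseteq> I" "A \<subseteq> I'"
      "\<And>x. x \<in> A \<Longrightarrow> f x = f' x"
      "(J, g) \<in> quot_pairs R F M" "(J', g') \<in> quot_pairs R F M" "B \<in> F" "B \<subseteq> J" "B \<subseteq> J'"
      "\<And>x. x \<in> B \<Longrightarrow> g x = g' x" for I f I' f' A J g J' g' B
    using that by (intro class_eqI[OF pair_add pair_add inter[of A B]]) auto
  have refl: "J \<in> F" if "(J, g) \<in> quot_pairs R F M" for J g
    using that by (rule pairD)
  have "(\<Union>(J, g)\<in>cls J g. ?h I f J g) = ?h I f J g" if "(I, f) \<in> quot_pairs R F M" for I f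
    by (rule UN_class[OF g]) (rule *[OF that that refl[OF that]], auto)
  moreover have "(\<Union>(I, f)\<in>cls I f. \<Union>(J, g)\<in>cls J g. ?h I f J g) = (\<Union>(J, g)\<in>cls J g. ?h I f J g)"
  proof (rule UN_class[OF f])
    fix I f I' f' A
    assume 1: "(I, f) \<in> quot_pairs R F M" "(I', f') \<in> quot_pairs R F M" "A \<in> F" "A \<subseteq> I" "A \<subseteq> I'"
      "\<And>x. x \<in> A \<Longrightarrow> f x = f' x"
    show "(\<Union>(J, g)\<in>cls J g. ?h I f J g) = (\<Union>(J, g)\<in>cls J g. ?h I' f' J g)"
    proof (intro SUP_cong HOL.refl)
      \<comment> \<open>Both inner unions run over the same class, so they are compared term by term
        with the second pair held fixed.\<close>
      fix p assume "p \<in> cls J g"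
      then obtain J' g' where p: "p = (J', g')" "(J', g') \<in> quot_pairs R F M"
        unfolding quot_class_def Image_singleton_iff by (rule quot_relE)
      show "(case p of (J, g) \<Rightarrow> ?h I f J g) = (case p of (J, g) \<Rightarrow> ?h I' f' J g)"
        unfolding p(1) prod.case by (rule *[OF 1 p(2) p(2) refl[OF p(2)]]) simp_all
    qed
  qed
  ultimately show ?thesis
    using f by (simp add: module_of_quotients_def)
qed

text \<open>Left multiplication by \<open>r\<close> is right linear and sends the colon ideal
  \<open>(I : r)\<close> into \<open>I\<close>; \<open>f\<close> is composed with it, and
  \<open>(I : r)\<close> belongs to \<open>F\<close> by the colon axiom.\<close>

lemma pair_rsmult:
  assumes f: "(I, f) \<in> quot_pairs R F M" and r: "r \<in> carrier R"
  shows "(right_colon R I r, \<lambda>s\<in>right_colon R I r. f (r \<otimes>\<^bsub>R\<^esub> s)) \<in> quot_pairs R F M"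
  using r
  by (intro pairI)
     (auto simp: right_colon_def pairD[OF f] colon[unfolded right_colon_def] R.r_distr
       R.m_assoc[symmetric])

lemma class_rsmult:
  assumes f: "(I, f) \<in> quot_pairs R F M" and r: "r \<in> carrier R"
  shows "cls I f \<triangleleft>\<^bsub>module_of_quotients R F M\<^esub> r
    = cls (right_colon R I r) (\<lambda>s\<in>right_colon R I r. f (r \<otimes>\<^bsub>R\<^esub> s))"
proof -
  let ?h = "\<lambda>I f. cls (right_colon R I r) (\<lambda>s\<in>right_colon R I r. f (r \<otimes>\<^bsub>R\<^esub> s))"
  have "(\<Union>(J, g)\<in>cls I f. ?h J g) = ?h I f"
  proof (rule UN_class[OF f])
    fix I f J g A
    assume *: "(I, f) \<in> quot_pairs R F M" "(J, g) \<in> quot_pairs R F M" "A \<in> F" "A \<subseteq> I" "A \<subseteq> J"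
      "\<And>x. x \<in> A \<Longrightarrow> f x = g x"
    show "?h I f = ?h J g"
      using * r by (intro class_eqI[OF pair_rsmult pair_rsmult colon[of A r]]) (auto simp: right_colon_def)
  qed
  then show ?thesis
    by (simp add: module_of_quotients_def)
qed

lemma pair_quot_map:
  assumes "m \<in> carrier M"
  shows "(carrier R, \<lambda>r\<in>carrier R. cos m \<triangleleft>\<^bsub>Q\<^esub> r) \<in> quot_pairs R F M"
  using assms
  by (intro pairI)
     (auto simp: carrier_mem Q.rsmult_add_right Q.rsmult_assoc Q.rsmult_closed simp del: rsmult_Q)

end


section \<open>Extending derivations\<close>

text \<open>Three regroupings for the map \<open>s \<mapsto> dbar (f s) - f (\<delta> s)\<close>
  used below: this one gives its additivity, the next cancels the Leibniz terms in its right
  linearity, and the third serves the Leibniz rule on the module of quotients.\<close>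

lemma (in abelian_group) add_minus_add:
  "\<lbrakk>a \<in> carrier G; b \<in> carrier G; c \<in> carrier G; e \<in> carrier G\<rbrakk>
    \<Longrightarrow> (a \<oplus> b) \<ominus> (c \<oplus> e) = (a \<ominus> c) \<oplus> (b \<ominus> e)"
  by (simp add: a_minus_def minus_add a_ac)

lemma (in abelian_group) add_minus_add_cancel:
  "\<lbrakk>a \<in> carrier G; b \<in> carrier G; c \<in> carrier G\<rbrakk> \<Longrightarrow> (a \<oplus> b) \<ominus> (c \<oplus> b) = a \<ominus> c"
  by (simp add: add_minus_add) (simp add: a_minus_def r_neg)

lemma (in abelian_group) minus_add_add_cancel:
  assumes "a \<in> carrier G" "b \<in> carrier G" "c \<in> carrier G"
  shows "(a \<ominus> (c \<oplus> b)) \<oplus> c = a \<ominus> b"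
proof -
  have "(a \<ominus> (c \<oplus> b)) \<oplus> c = (a \<oplus> c) \<ominus> (b \<oplus> c)"
    using assms by (simp add: a_minus_def a_ac)
  then show ?thesis
    using assms by (simp add: add_minus_add_cancel)
qed

locale gabriel_module_derivation = gabriel_module +
  fixes \<delta> d
  assumes derivation: "derivation R \<delta>" and module_derivation: "module_derivation R \<delta> M d"
begin

lemma delta_closed [simp]: "r \<in> carrier R \<Longrightarrow> \<delta> r \<in> carrier R"
  and delta_add: "\<lbrakk>r \<in> carrier R; s \<in> carrier R\<rbrakk> \<Longrightarrow> \<delta> (r \<oplus>\<^bsub>R\<^esub> s) = \<delta> r \<oplus>\<^bsub>R\<^esub> \<delta> s"
  and delta_mult: "\<lbrakk>r \<in> carrier R; s \<in> carrier R\<rbrakk> \<Longrightarrow> \<delta> (r \<otimes>\<^bsub>R\<^esub> s) = \<delta> r \<otimes>\<^bsub>R\<^esub> s \<oplus>\<^bsub>R\<^esub> r \<otimes>\<^bsub>R\<^esub> \<delta> s"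
  using derivation by (auto simp: derivation_def)

lemma d_closed [simp]: "x \<in> carrier M \<Longrightarrow> d x \<in> carrier M"
  and d_add: "\<lbrakk>x \<in> carrier M; y \<in> carrier M\<rbrakk> \<Longrightarrow> d (x \<oplus>\<^bsub>M\<^esub> y) = d x \<oplus>\<^bsub>M\<^esub> d y"
  and d_rsmult: "\<lbrakk>x \<in> carrier M; r \<in> carrier R\<rbrakk>
    \<Longrightarrow> d (x \<triangleleft>\<^bsub>M\<^esub> r) = d x \<triangleleft>\<^bsub>M\<^esub> r \<oplus>\<^bsub>M\<^esub> x \<triangleleft>\<^bsub>M\<^esub> \<delta> r"
  using module_derivation by (auto simp: module_derivation_def)

lemma delta_zero [simp]: "\<delta> \<zero>\<^bsub>R\<^esub> = \<zero>\<^bsub>R\<^esub>"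
  using delta_add[of "\<zero>\<^bsub>R\<^esub>" "\<zero>\<^bsub>R\<^esub>"] by (metis R.add.r_cancel_one' R.zero_closed delta_closed R.l_zero)

lemma d_zero [simp]: "d \<zero>\<^bsub>M\<^esub> = \<zero>\<^bsub>M\<^esub>"
  using d_add[of "\<zero>\<^bsub>M\<^esub>" "\<zero>\<^bsub>M\<^esub>"] by (metis M.add.r_cancel_one' M.zero_closed d_closed M.l_zero)

text \<open>For \<open>f\<close> with domain \<open>I\<close>, these are the \<open>s\<close> at
  which both \<open>f s\<close> and \<open>f (\<delta> s)\<close> make sense.\<close>

definition core where "core I = {s \<in> I. \<delta> s \<in> I}"

lemma core_mem:
  assumes "I \<in> F" shows "core I \<in> F"
proof (rule gabriel[OF assms])
  note I = right_ideals[OF assms]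
  show core: "right_ideal R (core I)"
    using right_ideal_zero[OF I] right_ideal_add[OF I] right_ideal_mult[OF I] mem_carrier[OF assms]
    by (intro R.right_idealI) (auto simp: core_def delta_add delta_mult)
  fix s assume s: "s \<in> I"
  show "right_colon R (core I) s \<in> F"
  proof (rule upward)
    show "right_colon R I (\<delta> s) \<in> F"
      using s mem_carrier[OF assms] by (intro colon[OF assms]) simp
    show "right_ideal R (right_colon R (core I) s)"
      using s mem_carrier[OF assms] by (intro R.right_ideal_colon[OF core])
    \<comment> \<open>If \<open>\<delta> s \<otimes> r \<in> I\<close>, then \<open>\<delta> (s
      \<otimes> r) = \<delta> s \<otimes> r \<oplus> s \<otimes> \<delta> r\<close> lies in
      \<open>I\<close>, the second summand because \<open>s \<in> I\<close>.\<close>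
    show "right_colon R I (\<delta> s) \<subseteq> right_colon R (core I) s"
      using s right_ideal_add[OF I] right_ideal_mult[OF I] mem_carrier[OF assms]
      by (auto simp: right_colon_def core_def delta_mult)
  qed
qed

text \<open>If \<open>I\<close> kills \<open>t\<close> and \<open>s \<in> core I\<close>, then
  \<open>0 = d (t s) = d t s + t (\<delta> s)\<close>, where the last term vanishes as
  \<open>\<delta> s \<in> I\<close>. Hence \<open>core I\<close> kills \<open>d t\<close>.\<close>

lemma d_torsion:
  assumes "t \<in> T" shows "d t \<in> T"
proof -
  obtain I where t: "t \<in> carrier M" and I: "I \<in> F" "\<forall>r\<in>I. t \<triangleleft>\<^bsub>M\<^esub> r = \<zero>\<^bsub>M\<^esub>"
    using assms by (auto simp: torsion_iff)
  show ?thesis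
  proof (rule torsionI[OF _ core_mem[OF I(1)]])
    fix s assume "s \<in> core I"
    then have s: "s \<in> carrier R" "s \<in> I" "\<delta> s \<in> I"
      using mem_carrier[OF I(1)] by (auto simp: core_def)
    then show "d t \<triangleleft>\<^bsub>M\<^esub> s = \<zero>\<^bsub>M\<^esub>"
      using d_rsmult[OF t s(1)] I(2) t by (simp add: rsmult_closed)
  qed (simp add: t)
qed

definition dbar where "dbar C = (\<Union>x\<in>C. cos (d x))"

lemma dbar_coset [simp]: "x \<in> carrier M \<Longrightarrow> dbar (cos x) = cos (d x)"
  unfolding dbar_def by (rule UN_coset) (simp add: d_add torsion_carrier coset_absorb d_torsion)

lemma dbar_closed [simp]: "C \<in> carrier Q \<Longrightarrow> dbar C \<in> carrier Q"
  by (auto elim!: carrier_QE)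

lemma dbar_add: "\<lbrakk>C \<in> carrier Q; D \<in> carrier Q\<rbrakk> \<Longrightarrow> dbar (C \<oplus>\<^bsub>Q\<^esub> D) = dbar C \<oplus>\<^bsub>Q\<^esub> dbar D"
  by (auto simp: d_add elim!: carrier_QE)

lemma dbar_rsmult:
  "\<lbrakk>C \<in> carrier Q; r \<in> carrier R\<rbrakk> \<Longrightarrow> dbar (C \<triangleleft>\<^bsub>Q\<^esub> r) = dbar C \<triangleleft>\<^bsub>Q\<^esub> r \<oplus>\<^bsub>Q\<^esub> C \<triangleleft>\<^bsub>Q\<^esub> \<delta> r"
  by (auto simp: d_rsmult rsmult_closed elim!: carrier_QE)

text \<open>The map measures how far \<open>f\<close> is from intertwining \<delta> with
  \<open>dbar\<close>. Both \<open>dbar (f (x r))\<close> and \<open>f (\<delta> (x r))\<close>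
  contain the term \<open>f x (\<delta> r)\<close>; it cancels in the difference, which is therefore
  right linear.\<close>

lemma pair_derivation:
  assumes f: "(I, f) \<in> quot_pairs R F M"
  shows "(core I, \<lambda>s\<in>core I. dbar (f s) \<ominus>\<^bsub>Q\<^esub> f (\<delta> s)) \<in> quot_pairs R F M"
proof (rule pairI)
  show "core I \<in> F"
    by (rule core_mem[OF pairD(1)[OF f]])
  fix x assume "x \<in> core I"
  then have x: "x \<in> carrier R" "x \<in> I" "\<delta> x \<in> I"
    using pairD(3)[OF f] by (auto simp: core_def)
  then show "dbar (f x) \<ominus>\<^bsub>Q\<^esub> f (\<delta> x) \<in> carrier Q"
    by (simp add: pairD(4)[OF f])
  {
    fix y assume "y \<in> core I"
    then have "y \<in> carrier R" "y \<in> I" "\<delta> y \<in> I"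
      using pairD(3)[OF f] by (auto simp: core_def)
    with x show "dbar (f (x \<oplus>\<^bsub>R\<^esub> y)) \<ominus>\<^bsub>Q\<^esub> f (\<delta> (x \<oplus>\<^bsub>R\<^esub> y))
      = (dbar (f x) \<ominus>\<^bsub>Q\<^esub> f (\<delta> x)) \<oplus>\<^bsub>Q\<^esub> (dbar (f y) \<ominus>\<^bsub>Q\<^esub> f (\<delta> y))"
      by (simp add: pairD(4,5)[OF f] delta_add dbar_add Q.M.add_minus_add)
  }
  {
    fix r assume r: "r \<in> carrier R"
    \<comment> \<open>Both summands of \<open>\<delta> (x \<otimes> r)\<close> must lie in
      \<open>I\<close> separately before \<open>f\<close> can be split over their sum.\<close>
    have "\<delta> x \<otimes>\<^bsub>R\<^esub> r \<in> I" "x \<otimes>\<^bsub>R\<^esub> \<delta> r \<in> I"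
      using x r right_ideal_mult[OF pairD(2)[OF f]] by simp_all
    with x r show "dbar (f (x \<otimes>\<^bsub>R\<^esub> r)) \<ominus>\<^bsub>Q\<^esub> f (\<delta> (x \<otimes>\<^bsub>R\<^esub> r))
      = (dbar (f x) \<ominus>\<^bsub>Q\<^esub> f (\<delta> x)) \<triangleleft>\<^bsub>Q\<^esub> r"
      by (simp add: pairD(4,5,6)[OF f] delta_mult dbar_rsmult Q.rsmult_closed Q.M.add_minus_add_cancel)
         (simp add: pairD(4)[OF f] a_minus_def Q.rsmult_add_left Q.minus_rsmult)
  }
qed

section \<open>The derivation on the module of quotients\<close>

definition qder where
  "qder X = (\<Union>(I, f)\<in>X. cls (core I) (\<lambda>s\<in>core I. dbar (f s) \<ominus>\<^bsub>Q\<^esub> f (\<delta> s)))"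

text \<open>Maps that agree on \<open>A\<close> agree at both \<open>s\<close> and
  \<open>\<delta> s\<close> for \<open>s \<in> core A\<close>, so the derived maps agree on
  \<open>core A\<close>.\<close>

lemma qder_class:
  assumes "(I, f) \<in> quot_pairs R F M"
  shows "qder (cls I f) = cls (core I) (\<lambda>s\<in>core I. dbar (f s) \<ominus>\<^bsub>Q\<^esub> f (\<delta> s))"
  unfolding qder_def
proof (rule UN_class[OF assms])
  fix I f J g A
  assume *: "(I, f) \<in> quot_pairs R F M" "(J, g) \<in> quot_pairs R F M" "A \<in> F" "A \<subseteq> I" "A \<subseteq> J"
    "\<And>x. x \<in> A \<Longrightarrow> f x = g x"
  show "cls (core I) (\<lambda>s\<in>core I. dbar (f s) \<ominus>\<^bsub>Q\<^esub> f (\<delta> s))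
    = cls (core J) (\<lambda>s\<in>core J. dbar (g s) \<ominus>\<^bsub>Q\<^esub> g (\<delta> s))"
    by (rule class_eqI[OF pair_derivation[OF *(1)] pair_derivation[OF *(2)] core_mem[OF *(3)]])
       (use *(4-6) in \<open>auto simp: core_def\<close>)
qed

text \<open>Both sides have the same domain, since \<open>core (I \<inter> J)\<close> is
  \<open>core I \<inter> core J\<close>, and their values there differ only by a regrouping.\<close>

lemma qder_add:
  assumes f: "(I, f) \<in> quot_pairs R F M" and g: "(J, g) \<in> quot_pairs R F M"
  shows "qder (cls I f \<oplus>\<^bsub>module_of_quotients R F M\<^esub> cls J g)
    = qder (cls I f) \<oplus>\<^bsub>module_of_quotients R F M\<^esub> qder (cls J g)"
  unfolding class_add[OF f g] qder_class[OF f] qder_class[OF g] qder_class[OF pair_add[OF f g]]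
    class_add[OF pair_derivation[OF f] pair_derivation[OF g]]
proof (rule class_eqI[OF pair_derivation[OF pair_add[OF f g]]
    pair_add[OF pair_derivation[OF f] pair_derivation[OF g]] core_mem])
  show "I \<inter> J \<in> F"
    using pairD(1) f g by (blast intro: inter)
qed (auto simp: core_def pairD(4)[OF f] pairD(4)[OF g] dbar_add Q.M.add_minus_add)

lemma qder_rsmult:
  assumes f: "(I, f) \<in> quot_pairs R F M" and r: "r \<in> carrier R"
  defines "m \<equiv> module_of_quotients R F M"
  shows "qder (cls I f \<triangleleft>\<^bsub>m\<^esub> r) = qder (cls I f) \<triangleleft>\<^bsub>m\<^esub> r \<oplus>\<^bsub>m\<^esub> cls I f \<triangleleft>\<^bsub>m\<^esub> \<delta> r"
proof -
  note dr = delta_closed[OF r]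
  note lhs = pair_derivation[OF pair_rsmult[OF f r]]
  note rhs1 = pair_rsmult[OF pair_derivation[OF f] r]
  note rhs2 = pair_rsmult[OF f dr]
  \<comment> \<open>\<open>?K\<close> is the domain of the sum on the right. It is intersected below
    with \<open>core (right_colon R I r)\<close>, the domain on the left, so that every term
    occurring is defined.\<close>
  let ?K = "right_colon R (core I) r \<inter> right_colon R I (\<delta> r)"
  have "?K \<inter> core (right_colon R I r) \<in> F"
    by (intro inter core_mem colon pairD(1)[OF f] r dr)
  then have "cls (core (right_colon R I r)) (\<lambda>s\<in>core (right_colon R I r).
      dbar ((\<lambda>s\<in>right_colon R I r. f (r \<otimes>\<^bsub>R\<^esub> s)) s)
        \<ominus>\<^bsub>Q\<^esub> (\<lambda>s\<in>right_colon R I r. f (r \<otimes>\<^bsub>R\<^esub> s)) (\<delta> s))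
    = cls ?K (\<lambda>s\<in>?K.
        (\<lambda>s\<in>right_colon R (core I) r. (\<lambda>s\<in>core I. dbar (f s) \<ominus>\<^bsub>Q\<^esub> f (\<delta> s)) (r \<otimes>\<^bsub>R\<^esub> s)) s
        \<oplus>\<^bsub>Q\<^esub> (\<lambda>s\<in>right_colon R I (\<delta> r). f (\<delta> r \<otimes>\<^bsub>R\<^esub> s)) s)"
  proof (rule class_eqI[OF lhs pair_add[OF rhs1 rhs2]])
    fix s assume "s \<in> ?K \<inter> core (right_colon R I r)"
    then have s: "s \<in> core (right_colon R I r)" "s \<in> right_colon R (core I) r"
        "s \<in> right_colon R I (\<delta> r)" "s \<in> right_colon R I r" "\<delta> s \<in> right_colon R I r" "r \<otimes>\<^bsub>R\<^esub> s \<in> core I"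
        "s \<in> carrier R" "r \<otimes>\<^bsub>R\<^esub> s \<in> I" "\<delta> r \<otimes>\<^bsub>R\<^esub> s \<in> I" "r \<otimes>\<^bsub>R\<^esub> \<delta> s \<in> I"
      by (auto simp: core_def right_colon_def)
    \<comment> \<open>Expanding \<open>\<delta> (r \<otimes> s)\<close> on the right produces
      \<open>f (\<delta> r \<otimes> s)\<close> with a minus sign, and the class of \<open>f\<close>
      times \<open>\<delta> r\<close> contributes the same term with a plus sign.\<close>
    have "dbar (f (r \<otimes>\<^bsub>R\<^esub> s)) \<ominus>\<^bsub>Q\<^esub> f (r \<otimes>\<^bsub>R\<^esub> \<delta> s)
      = (dbar (f (r \<otimes>\<^bsub>R\<^esub> s)) \<ominus>\<^bsub>Q\<^esub> f (\<delta> (r \<otimes>\<^bsub>R\<^esub> s))) \<oplus>\<^bsub>Q\<^esub> f (\<delta> r \<otimes>\<^bsub>R\<^esub> s)"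
      using s r
      by (simp add: delta_mult pairD(4,5)[OF f] Q.M.minus_add_add_cancel)
    then show "(\<lambda>s\<in>core (right_colon R I r).
        dbar ((\<lambda>s\<in>right_colon R I r. f (r \<otimes>\<^bsub>R\<^esub> s)) s)
          \<ominus>\<^bsub>Q\<^esub> (\<lambda>s\<in>right_colon R I r. f (r \<otimes>\<^bsub>R\<^esub> s)) (\<delta> s)) s
      = (\<lambda>s\<in>?K.
        (\<lambda>s\<in>right_colon R (core I) r. (\<lambda>s\<in>core I. dbar (f s) \<ominus>\<^bsub>Q\<^esub> f (\<delta> s)) (r \<otimes>\<^bsub>R\<^esub> s)) s
        \<oplus>\<^bsub>Q\<^esub> (\<lambda>s\<in>right_colon R I (\<delta> r). f (\<delta> r \<otimes>\<^bsub>R\<^esub> s)) s) s"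
      using s by simp
  qed auto
  then show ?thesis
    unfolding m_def class_rsmult[OF f r] class_rsmult[OF f dr] qder_class[OF f]
      qder_class[OF pair_rsmult[OF f r]] class_rsmult[OF pair_derivation[OF f] r]
      class_add[OF rhs1 rhs2] .
qed

text \<open>For left multiplication by the coset of \<open>x\<close>, the Leibniz rule for
  \<open>dbar\<close> turns the formula into left multiplication by the coset of \<open>d x\<close>.
  Cosets are kept unexpanded by the simplifier so that this rule applies.\<close>

lemma qder_quot_map:
  assumes "x \<in> carrier M"
  shows "qder (quot_map R F M x) = quot_map R F M (d x)"
  unfolding quot_map_def qder_class[OF pair_quot_map[OF assms]]
proof (rule class_eqI[OF pair_derivation[OF pair_quot_map[OF assms]] pair_quot_map core_mem[OF carrier_mem]])
  fix s assume "s \<in> core (carrier R)"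
  then have s: "s \<in> core (carrier R)" "s \<in> carrier R"
    by (auto simp: core_def)
  have "dbar (cos x \<triangleleft>\<^bsub>Q\<^esub> s) \<ominus>\<^bsub>Q\<^esub> cos x \<triangleleft>\<^bsub>Q\<^esub> \<delta> s = dbar (cos x) \<triangleleft>\<^bsub>Q\<^esub> s"
    using assms s(2) by (simp add: dbar_rsmult Q.rsmult_closed a_minus_def Q.M.a_assoc Q.M.r_neg del: rsmult_Q dbar_coset)
  then show "(\<lambda>s\<in>core (carrier R). dbar ((\<lambda>r\<in>carrier R. cos x \<triangleleft>\<^bsub>Q\<^esub> r) s)
      \<ominus>\<^bsub>Q\<^esub> (\<lambda>r\<in>carrier R. cos x \<triangleleft>\<^bsub>Q\<^esub> r) (\<delta> s)) s = (\<lambda>r\<in>carrier R. cos (d x) \<triangleleft>\<^bsub>Q\<^esub> r) s"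
    using assms s by (simp del: rsmult_Q)
qed (use assms in \<open>auto simp: core_def\<close>)

theorem qder_is_extension: "is_extension R \<delta> F M d qder"
proof -
  have "qder \<in> carrier (module_of_quotients R F M) \<rightarrow> carrier (module_of_quotients R F M)"
    by (auto elim!: classE simp: qder_class intro!: class_closed pair_derivation)
  then show ?thesis
    unfolding is_extension_def module_derivation_def
    by (auto elim!: classE simp: qder_add qder_rsmult qder_quot_map)
qed

end


section \<open>Comparison of two filters\<close>

text \<open>Needed to carry the difference in the formula for \<open>qder\<close> through the
  projection between the two quotients, which is evaluated on representatives.\<close>

lemma (in gabriel_module) minus_Q:
  assumes "x \<in> carrier M" "y \<in> carrier M"
  shows "cos x \<ominus>\<^bsub>Q\<^esub> cos y = cos (x \<ominus>\<^bsub>M\<^esub> y)"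
proof -
  have "\<ominus>\<^bsub>Q\<^esub> cos y = cos (\<ominus>\<^bsub>M\<^esub> y)"
    using assms by (intro Q.M.minus_equality) (simp_all add: zero_Q M.l_neg)
  then show ?thesis
    using assms by (simp add: a_minus_def)
qed

locale gabriel_module_pair = G1: gabriel_module R F\<^sub>1 M + G2: gabriel_module R F\<^sub>2 M
  for R (structure) and F\<^sub>1 F\<^sub>2 and M :: "('r, 'm, 'x) right_module_scheme" (structure) +
  assumes filter_subset: "F\<^sub>1 \<subseteq> F\<^sub>2"
begin

text \<open>The projection from \<open>M\<close> modulo its \<open>F\<^sub>1\<close>-torsion to
  \<open>M\<close> modulo its \<open>F\<^sub>2\<close>-torsion, in the form in which it occurs
  inside \<open>quot_transition\<close>.\<close>

definition proj where "proj C = (\<Union>x\<in>C. torsion R F\<^sub>2 M +>\<^bsub>M\<^esub> x)"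

lemma proj_coset [simp]:
  assumes "x \<in> carrier M"
  shows "proj (torsion R F\<^sub>1 M +>\<^bsub>M\<^esub> x) = torsion R F\<^sub>2 M +>\<^bsub>M\<^esub> x"
proof -
  have "torsion R F\<^sub>1 M \<subseteq> torsion R F\<^sub>2 M"
    using filter_subset by (auto simp: torsion_def)
  then show ?thesis
    unfolding proj_def using assms by (intro G1.UN_coset) (auto simp: G2.coset_absorb)
qed

lemma pair_proj:
  assumes f: "(I, f) \<in> quot_pairs R F\<^sub>1 M"
  shows "(I, \<lambda>s\<in>I. proj (f s)) \<in> quot_pairs R F\<^sub>2 M"
proof (rule G2.pairI)
  show "I \<in> F\<^sub>2"
    using G1.pairD(1)[OF f] filter_subset by blast
  fix x assume x: "x \<in> I"
  obtain a where a: "a \<in> carrier M" "f x = torsion R F\<^sub>1 M +>\<^bsub>M\<^esub> a"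
    using G1.pairD(4)[OF f x] by (rule G1.carrier_QE)
  then show "proj (f x) \<in> carrier (torsion_quotient R F\<^sub>2 M)"
    by simp
  show "proj (f (x \<otimes>\<^bsub>R\<^esub> r)) = proj (f x) \<triangleleft>\<^bsub>torsion_quotient R F\<^sub>2 M\<^esub> r" if "r \<in> carrier R" for r
    using that a by (simp add: G1.pairD(6)[OF f x] G1.rsmult_closed)
  fix y assume y: "y \<in> I"
  obtain b where "b \<in> carrier M" "f y = torsion R F\<^sub>1 M +>\<^bsub>M\<^esub> b"
    using G1.pairD(4)[OF f y] by (rule G1.carrier_QE)
  with a show "proj (f (x \<oplus>\<^bsub>R\<^esub> y)) = proj (f x) \<oplus>\<^bsub>torsion_quotient R F\<^sub>2 M\<^esub> proj (f y)"
    by (simp add: G1.pairD(5)[OF f x y])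
qed

text \<open>A member of \<open>F\<^sub>1\<close> on which two representatives agree is also a member
  of \<open>F\<^sub>2\<close>, and their projections agree on it.\<close>

lemma quot_transition_class:
  assumes "(I, f) \<in> quot_pairs R F\<^sub>1 M"
  shows "quot_transition R F\<^sub>1 F\<^sub>2 M (quot_class R F\<^sub>1 M I f) = quot_class R F\<^sub>2 M I (\<lambda>s\<in>I. proj (f s))"
  unfolding quot_transition_def proj_def[symmetric]
proof (rule G1.UN_class[OF assms])
  fix I f J g A
  assume *: "(I, f) \<in> quot_pairs R F\<^sub>1 M" "(J, g) \<in> quot_pairs R F\<^sub>1 M" "A \<in> F\<^sub>1" "A \<subseteq> I" "A \<subseteq> J"
    "\<And>x. x \<in> A \<Longrightarrow> f x = g x"
  show "quot_class R F\<^sub>2 M I (\<lambda>s\<in>I. proj (f s)) = quot_class R F\<^sub>2 M J (\<lambda>s\<in>J. proj (g s))"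
    by (rule G2.class_eqI[OF pair_proj[OF *(1)] pair_proj[OF *(2)], of A])
       (use * filter_subset in auto)
qed

end

section \<open>Agreement of the extensions\<close>

theorem extensions_agree_module:
  fixes R :: "('r, 'e) ring_scheme" and M :: "('r, 'm, 'x) right_module_scheme"
  assumes "gabriel_filter R F\<^sub>1" and "gabriel_filter R F\<^sub>2" and "F\<^sub>1 \<subseteq> F\<^sub>2"
    and "right_module R M" and "derivation R \<delta>" and "module_derivation R \<delta> M d"
  shows "extensions_agree R \<delta> F\<^sub>1 F\<^sub>2 M d"
proof -
  interpret D1: gabriel_module_derivation R F\<^sub>1 M \<delta> d
    using assms by (intro gabriel_module_derivation.intro gabriel_module.intro
      gabriel_module_derivation_axioms.intro)
  interpret D2: gabriel_module_derivation R F\<^sub>2 M \<delta> d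
    using assms by (intro gabriel_module_derivation.intro gabriel_module.intro
      gabriel_module_derivation_axioms.intro)
  interpret P: gabriel_module_pair R F\<^sub>1 F\<^sub>2 M
    by unfold_locales (rule assms)
  have "D2.qder (quot_transition R F\<^sub>1 F\<^sub>2 M X) = quot_transition R F\<^sub>1 F\<^sub>2 M (D1.qder X)"
    if X: "X \<in> carrier (module_of_quotients R F\<^sub>1 M)" for X
  proof -
    obtain I f where f: "(I, f) \<in> quot_pairs R F\<^sub>1 M" and X: "X = quot_class R F\<^sub>1 M I f"
      using X by (rule D1.classE)
    show ?thesis
      unfolding X P.quot_transition_class[OF f] D1.qder_class[OF f] D2.qder_class[OF P.pair_proj[OF f]]
        P.quot_transition_class[OF D1.pair_derivation[OF f]]
    proof (rule D2.class_eqI[OF D2.pair_derivation[OF P.pair_proj[OF f]]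
        P.pair_proj[OF D1.pair_derivation[OF f]]])
      \<comment> \<open>The set \<open>core I\<close> is built from \<delta> and \<open>I\<close>
        alone, so \<open>D1.core I\<close> and \<open>D2.core I\<close> coincide and both
        representatives have this domain.\<close>
      show "D2.core I \<in> F\<^sub>2"
        by (rule D2.core_mem[OF D2.pairD(1)[OF P.pair_proj[OF f]]])
      fix s assume "s \<in> D2.core I"
      then have s: "s \<in> D2.core I" "s \<in> I" "\<delta> s \<in> I"
        by (auto simp: D2.core_def)
      obtain a where a: "a \<in> carrier M" "f s = torsion R F\<^sub>1 M +>\<^bsub>M\<^esub> a"
        using D1.pairD(4)[OF f s(2)] by (rule D1.carrier_QE)
      obtain b where b: "b \<in> carrier M" "f (\<delta> s) = torsion R F\<^sub>1 M +>\<^bsub>M\<^esub> b"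
        using D1.pairD(4)[OF f s(3)] by (rule D1.carrier_QE)
      \<comment> \<open>With \<open>f s\<close> and \<open>f (\<delta> s)\<close> represented by
        \<open>a\<close> and \<open>b\<close>, both sides become the coset of \<open>d a - b\<close>
        modulo the \<open>F\<^sub>2\<close>-torsion.\<close>
      show "(\<lambda>s\<in>D2.core I. D2.dbar ((\<lambda>s\<in>I. P.proj (f s)) s)
          \<ominus>\<^bsub>torsion_quotient R F\<^sub>2 M\<^esub> (\<lambda>s\<in>I. P.proj (f s)) (\<delta> s)) s
        = (\<lambda>s\<in>D1.core I. P.proj ((\<lambda>s\<in>D1.core I. D1.dbar (f s)
          \<ominus>\<^bsub>torsion_quotient R F\<^sub>1 M\<^esub> f (\<delta> s)) s)) s"
        using s a b by (simp add: D1.minus_Q D2.minus_Q)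
    qed simp_all
  qed
  then show ?thesis
    using D1.qder_is_extension D2.qder_is_extension unfolding extensions_agree_def by blast
qed

theorem corollary1:
  fixes R :: "('r, 'e) ring_scheme" and F\<^sub>1 F\<^sub>2 :: "'r set set"
  assumes "ring R"
    and "gabriel_filter R F\<^sub>1" and "gabriel_filter R F\<^sub>2" and "F\<^sub>1 \<subseteq> F\<^sub>2"
    and "(differential_filter R F\<^sub>1 \<and> torsion_free R F\<^sub>2 (ring_of_quotients R F\<^sub>1)) \<or>
         (differential_filter R F\<^sub>1 \<and> differential_filter R F\<^sub>2) \<or>
         (faithful_filter R F\<^sub>1 \<and> faithful_filter R F\<^sub>2)"
  shows "\<forall>\<delta>. derivation R \<delta> \<longrightarrow>
           extends R \<delta> F\<^sub>1 (right_regular R) \<delta> \<and>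
           extends R \<delta> F\<^sub>2 (right_regular R) \<delta> \<and>
           extensions_agree R \<delta> F\<^sub>1 F\<^sub>2 (right_regular R) \<delta>"
proof (intro allI impI)
  fix \<delta> assume \<delta>: "derivation R \<delta>"
  \<comment> \<open>The module result is applied with \<open>M = R\<close> and
    \<open>d = \<delta>\<close>: on the right regular module, the product rule is the module Leibniz
    rule.\<close>
  then have "module_derivation R \<delta> (right_regular R) \<delta>"
    by (simp add: derivation_def module_derivation_def right_regular_def)
  with assms \<delta> have "extensions_agree R \<delta> F\<^sub>1 F\<^sub>2 (right_regular R) \<delta>"
    by (intro extensions_agree_module ring.right_regular_module)
  \<comment> \<open>The pair of maps witnessing agreement also witnesses the two separate
    extensions.\<close>
  then show "extends R \<delta> F\<^sub>1 (right_regular R) \<delta> \<and> extends R \<delta> F\<^sub>2 (right_regular R) \<delta> \<and>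
      extensions_agree R \<delta> F\<^sub>1 F\<^sub>2 (right_regular R) \<delta>"
    unfolding extends_def extensions_agree_def by blast
qed

end
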